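(* Let $r\colon \mathbb{N}_0 \to \{\pm 1\}$ be the Rudin-Shapiro sequence. For every $s \in \mathbb{N}$ there exists $c = c(s) > 0$ such that $\|r\|_{U^s[N]} = O(N^{-c})$ as $N \to \infty$.
   Context: The Rudin-Shapiro sequence is $r(n) = (-1)^{f_{11}(n)}$, where $f_{11}(n)$ is the number of (possibly overlapping) occurrences of the block $11$ in the binary expansion of $n$; equivalently $r(0)=1$, $r(2n)=r(n)$, $r(4n+1)=r(n)$, $r(4n+3)=-r(2n+1)$. For $N \in \mathbb{N}$ write $[N] = \{0,1,\dots,N-1\}$. For $s\in\mathbb{N}$ and $f\colon [N]\to\mathbb{R}$, the Gowers uniformity norm is defined by $\|f\|_{U^s[N]}^{2^s} = \mathbb{E}_{n,\mathbf h} \prod_{\omega\in\{0,1\}^s} f(n+\omega\cdot \mathbf h)$, where $\omega\cdot\mathbf h = \sum_{i=1}^s \omega_i h_i$ and the expectation is over all $n\in\mathbb{Z}$, $\mathbf h\in\mathbb{Z}^s$ such that the cube $\{n+\omega\cdot\mathbf h : \omega\in\{0,1\}^s\}$ is contained in $[N]$. Here $\|r\|_{U^s[N]}$ means the norm of the restriction of $r$ to $[N]$. *)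

theory Defs
  imports "HOL-Analysis.Analysis" "HOL-Library.Landau_Symbols"
begin

text \<open>Number of (possibly overlapping) occurrences of the block 11 in the binary
  expansion of n: the block ending at the lowest bit is present iff n mod 4 = 3.\<close>
fun f11 :: "nat \<Rightarrow> nat" where
  "f11 n = (if n < 2 then 0 else f11 (n div 2) + (if n mod 4 = 3 then 1 else 0))"

definition rudin_shapiro :: "nat \<Rightarrow> real" where
  "rudin_shapiro n = (-1) ^ f11 n"

definition cube_dot :: "bool list \<Rightarrow> int list \<Rightarrow> int" where
  "cube_dot \<omega> h = sum_list (map2 (\<lambda>b x. if b then x else 0) \<omega> h)"

definition omegas :: "nat \<Rightarrow> bool list set" where
  "omegas s = {\<omega>. length \<omega> = s}"

definition cubes :: "nat \<Rightarrow> nat \<Rightarrow> (int \<times> int list) set" where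
  "cubes s N = {(n, h). length h = s \<and>
      (\<forall>\<omega>\<in>omegas s. 0 \<le> n + cube_dot \<omega> h \<and> n + cube_dot \<omega> h < int N)}"

definition gowers_pow :: "nat \<Rightarrow> nat \<Rightarrow> (nat \<Rightarrow> real) \<Rightarrow> real" where
  "gowers_pow s N f = (\<Sum>(n, h)\<in>cubes s N. \<Prod>\<omega>\<in>omegas s. f (nat (n + cube_dot \<omega> h)))
      / real (card (cubes s N))"

definition gowers_norm :: "nat \<Rightarrow> nat \<Rightarrow> (nat \<Rightarrow> real) \<Rightarrow> real" where
  "gowers_norm s N f = root (2 ^ s) (gowers_pow s N f)"

end

theory Submission
  imports Defs
begin

text \<open>
  Write a cube as a vector \<open>p = (n, h)\<close> with vertices \<open>w \<cdot> p\<close>. With \<open>g\<^sub>b(n) = r(2 n + b)\<close>, removing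
  a block of low binary digits from all entries of \<open>p\<close> turns a product of values
  \<open>g\<^sub>b(w \<cdot> p + c)\<close> (the bit \<open>b\<close> and the carry \<open>c\<close> depending on \<open>w\<close>) into a sign times a
  product of the same kind, and the carries stay bounded. If the block is long enough, two of its
  possible values lead to vanishing bits and carries but have opposite signs: the value \<open>0\<close>,
  and a shift of a cube on which the product of \<open>r\<close> is \<open>-1\<close>. Such a cube is
  \<open>n = 2^s\<close>, \<open>h = (2^(s-2), \<dots>, 2, 1, 1)\<close>, where the product telescopes to
  \<open>r(n) r(n + 2^(s-1))\<close>. So each block of digits gains a factor \<open>1 - 2 / Q^(s+1)\<close> over the
  trivial bound. Finally, the cubes in \<open>[N]\<close> are cut into full boxes of side about
  \<open>sqrt N\<close>; the cubes in incomplete boxes have a vertex near the ends of \<open>[N]\<close> and are negligible.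
\<close>

section \<open>Subset sums of vectors and splitting off low digits\<close>

text \<open>A polymorphic form of \<open>cube_dot\<close>: digit vectors live over the naturals,
  while the steps of a cube may be negative integers.\<close>

definition cdot :: "bool list \<Rightarrow> 'a::comm_monoid_add list \<Rightarrow> 'a" where
  "cdot w h = sum_list (map2 (\<lambda>b x. if b then x else 0) w h)"

lemma cdot_Nil [simp]: "cdot [] h = 0" "cdot w [] = 0"
  by (simp_all add: cdot_def)

lemma cdot_Cons [simp]: "cdot (b # w) (x # h) = (if b then x else 0) + cdot w h"
  by (simp add: cdot_def)

lemma cube_dot_eq_cdot: "cube_dot w h = cdot w h"
  by (simp add: cube_dot_def cdot_def)

lemma cdot_le:
  fixes p :: "nat list"
  assumes "length w = length p" "\<And>x. x \<in> set p \<Longrightarrow> x \<le> c"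
  shows "cdot w p \<le> length p * c"
  using assms
proof (induction w p rule: list_induct2)
  case (Cons b w x p)
  have "x \<le> c" "cdot w p \<le> length p * c"
    using Cons by auto
  then show ?case by auto
qed simp

lemma cdot_map_of_nat:
  "cdot w (map of_nat p) = (of_nat (cdot w p) :: 'a::comm_semiring_1)"
proof (induction w arbitrary: p)
  case (Cons b w)
  then show ?case by (cases p) auto
qed simp

lemma cdot_map_mult:
  fixes c :: "'a::comm_semiring_1"
  shows "cdot w (map ((*) c) p) = c * cdot w p"
proof (induction w arbitrary: p)
  case (Cons b w)
  then show ?case by (cases p) (auto simp: algebra_simps)
qed simp

text \<open>The digit vector \<open>e\<close> is natural even when \<open>q\<close> has integer
  entries: remainders modulo a positive \<open>M\<close> are nonnegative, so the signs are absorbed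
  by \<open>q\<close>.\<close>

definition combine :: "'a::comm_semiring_1 \<Rightarrow> 'a list \<Rightarrow> nat list \<Rightarrow> 'a list" where
  "combine M q e = map2 (\<lambda>x y. M * x + of_nat y) q e"

lemma length_combine [simp]: "length (combine M q e) = min (length q) (length e)"
  by (simp add: combine_def)

lemma cdot_combine:
  assumes "length w = length q" "length q = length e"
  shows "cdot w (combine M q e) = M * cdot w q + of_nat (cdot w e)"
  using assms
  by (induction w q e rule: list_induct3) (auto simp: combine_def algebra_simps)

definition list_box :: "nat \<Rightarrow> nat \<Rightarrow> nat list set" where
  "list_box d M = {p. set p \<subseteq> {0..<M} \<and> length p = d}"

lemma finite_list_box [simp]: "finite (list_box d M)"
  unfolding list_box_def by (rule finite_lists_length_eq) simp

lemma card_list_box: "card (list_box d M) = M ^ d"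
  unfolding list_box_def by (subst card_lists_length_eq) auto

lemma cdot_list_box_le:
  assumes "p \<in> list_box d M" "length w = d"
  shows "cdot w p \<le> d * (M - 1)"
  using cdot_le[of w p "M - 1"] assms by (force simp: list_box_def)

lemma combine_div_mod:
  fixes q :: "nat list"
  assumes "length q = length e" "set e \<subseteq> {0..<Q}"
  shows "map (\<lambda>x. x div Q) (combine Q q e) = q" "map (\<lambda>x. x mod Q) (combine Q q e) = e"
  using assms by (induction q e rule: list_induct2) (auto simp: combine_def)

lemma combine_div_mod_int:
  fixes q :: "int list"
  assumes "length q = length e" "set e \<subseteq> {0..<Q}"
  shows "map (\<lambda>x. x div int Q) (combine (int Q) q e) = q"
    and "map (\<lambda>x. nat (x mod int Q)) (combine (int Q) q e) = e"
  using assms by (induction q e rule: list_induct2) (auto simp: combine_def)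

lemma combine_of_div_mod: "combine Q (map (\<lambda>x. x div Q) p) (map (\<lambda>x. x mod Q) p) = (p::nat list)"
  by (induction p) (auto simp: combine_def)

lemma combine_of_div_mod_int:
  assumes "Q > 0"
  shows "combine (int Q) (map (\<lambda>x. x div int Q) p) (map (\<lambda>x. nat (x mod int Q)) p) = p"
  using assms by (induction p) (auto simp: combine_def)

text \<open>Division with remainder by \<open>Q\<close> in each coordinate is a bijection from the
  box of side \<open>Q * M\<close> onto pairs of a low-digit vector and a quotient vector.\<close>

lemma sum_list_box_mult:
  assumes "Q > 0"
  shows "sum F (list_box d (Q * M)) = (\<Sum>e\<in>list_box d Q. \<Sum>q\<in>list_box d M. F (combine Q q e))"
proof -
  have "sum F (list_box d (Q * M)) = (\<Sum>(e, q)\<in>list_box d Q \<times> list_box d M. F (combine Q q e))"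
  proof (rule sum.reindex_bij_witness[where
      i = "\<lambda>(e, q). combine Q q e" and j = "\<lambda>p. (map (\<lambda>x. x mod Q) p, map (\<lambda>x. x div Q) p)"])
    fix p assume p: "p \<in> list_box d (Q * M)"
    then show "(map (\<lambda>x. x mod Q) p, map (\<lambda>x. x div Q) p) \<in> list_box d Q \<times> list_box d M"
      using assms by (auto simp: list_box_def less_mult_imp_div_less mult.commute)
  next
    fix eq assume "eq \<in> list_box d Q \<times> list_box d M"
    then obtain e q where eq: "eq = (e, q)" "e \<in> list_box d Q" "q \<in> list_box d M" by auto
    have lt: "x + Q * y < Q * M" if "x < Q" "y < M" for x y
    proof -
      have "x + Q * y < Q * (y + 1)" using that by simp
      also have "\<dots> \<le> Q * M" using that by (intro mult_le_mono2) simp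
      finally show ?thesis .
    qed
    have "y + Q * x < Q * M" if "(x, y) \<in> set (zip q e)" for x y
      using eq set_zip_leftD[OF that] set_zip_rightD[OF that] by (intro lt) (auto simp: list_box_def)
    then have "x \<in> set (combine Q q e) \<Longrightarrow> x < Q * M" for x
      unfolding combine_def by (auto simp: add.commute)
    then show "(case eq of (e, q) \<Rightarrow> combine Q q e) \<in> list_box d (Q * M)"
      using eq by (auto simp: list_box_def)
    show "(map (\<lambda>x. x mod Q) (case eq of (e, q) \<Rightarrow> combine Q q e),
        map (\<lambda>x. x div Q) (case eq of (e, q) \<Rightarrow> combine Q q e)) = eq"
      using eq combine_div_mod[of q e Q] by (auto simp: list_box_def)
  qed (auto simp: combine_of_div_mod)
  then show ?thesis by (simp add: sum.cartesian_product)
qed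

section \<open>Digit recursion for the Rudin-Shapiro sequence\<close>

declare f11.simps [simp del]

lemma f11_0 [simp]: "f11 0 = 0" and f11_1 [simp]: "f11 (Suc 0) = 0"
  by (simp_all add: f11.simps)

lemma f11_rec: "f11 n = f11 (n div 2) + (if n mod 4 = 3 then 1 else 0)"
proof (cases "n < 2")
  case True
  then have "n = 0 \<or> n = 1" by auto
  then show ?thesis by auto
next
  case False
  then show ?thesis by (subst f11.simps) simp
qed

text \<open>Cut the expansion above the \<open>k + 1\<close> digits of \<open>t\<close>. Blocks
  inside \<open>t\<close> are counted by \<open>f11 t\<close>; a block straddling the cut needs the
  top digit \<open>t div 2 ^ k\<close>, so that digit is kept below \<open>m\<close> in the second
  term. The induction removes the lowest digit of \<open>t\<close>.\<close>

lemma f11_concat: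
  assumes "t < 2 ^ (k + 1)"
  shows "f11 (2 ^ (k + 1) * m + t) = f11 t + f11 (2 * m + t div 2 ^ k)"
  using assms
proof (induction k arbitrary: t)
  case 0
  then have "t = 0 \<or> t = 1" by auto
  then show ?case by auto
next
  case (Suc k)
  have e: "2 ^ (Suc k + 1) * m + t = 4 * (2 ^ k * m) + t" by simp
  have d: "(2 ^ (Suc k + 1) * m + t) div 2 = 2 ^ (k + 1) * m + t div 2" by simp
  have r: "(2 ^ (Suc k + 1) * m + t) mod 4 = t mod 4" unfolding e by simp
  have "f11 (2 ^ (Suc k + 1) * m + t) = f11 (2 ^ (k + 1) * m + t div 2) + (if t mod 4 = 3 then 1 else 0)"
    by (subst f11_rec) (simp only: d r)
  also have "f11 (2 ^ (k + 1) * m + t div 2) = f11 (t div 2) + f11 (2 * m + t div 2 div 2 ^ k)"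
    using Suc.prems by (intro Suc.IH) auto
  also have "t div 2 div 2 ^ k = t div 2 ^ Suc k"
    by (simp add: div_mult2_eq)
  finally show ?case using f11_rec[of t] by simp
qed

lemma rudin_shapiro_concat:
  assumes "t < 2 ^ (k + 1)"
  shows "rudin_shapiro (2 ^ (k + 1) * m + t)
    = rudin_shapiro t * rudin_shapiro (2 * m + t div 2 ^ k)"
  unfolding rudin_shapiro_def f11_concat[OF assms] by (simp add: power_add)

lemma rudin_shapiro_0 [simp]: "rudin_shapiro 0 = 1"
  by (simp add: rudin_shapiro_def)

lemma rudin_shapiro_1 [simp]: "rudin_shapiro (Suc 0) = 1"
  by (simp add: rudin_shapiro_def)

lemma rudin_shapiro_3: "rudin_shapiro 3 = -1"
  by (simp add: rudin_shapiro_def f11.simps)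

lemma rudin_shapiro_double [simp]: "rudin_shapiro (2 * n) = rudin_shapiro n"
  unfolding rudin_shapiro_def by (subst f11_rec) (auto, presburger)

lemma rudin_shapiro_power2_mult [simp]: "rudin_shapiro (2 ^ k * n) = rudin_shapiro n"
proof (induction k)
  case (Suc k)
  then show ?case using rudin_shapiro_double[of "2 ^ k * n"] by (simp add: mult.assoc)
qed simp

lemma abs_rudin_shapiro [simp]: "\<bar>rudin_shapiro n\<bar> = 1"
  by (simp add: rudin_shapiro_def power_abs)

lemma rudin_shapiro_square [simp]: "rudin_shapiro n * rudin_shapiro n = 1"
  by (metis abs_rudin_shapiro abs_mult_self_eq mult_1)

text \<open>\<open>rs_bit True\<close> is the sequence \<open>(-1)^n r(n)\<close>, which arises when a bit 1 is removed below \<open>n\<close>.\<close>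

definition rs_bit :: "bool \<Rightarrow> nat \<Rightarrow> real" where
  "rs_bit b n = rudin_shapiro (2 * n + of_bool b)"

lemma rs_bit_False [simp]: "rs_bit False n = rudin_shapiro n"
  by (simp add: rs_bit_def)

lemma abs_rs_bit [simp]: "\<bar>rs_bit b n\<bar> = 1"
  by (simp add: rs_bit_def)

text \<open>The bit \<open>b\<close> sits below \<open>t\<close> and affects only the sign of the
  low part; from \<open>m\<close> only the top digit of \<open>t\<close> is visible. So the family
  \<open>rs_bit\<close> is closed under removing blocks of digits, with one bit of memory.\<close>

lemma rs_bit_concat:
  assumes "t < 2 ^ (k + 1)"
  shows "rs_bit b (2 ^ (k + 1) * m + t) = rs_bit b t * rs_bit (2 ^ k \<le> t) m"
proof -
  have "rs_bit b (2 ^ (k + 1) * m + t) = rudin_shapiro (2 ^ (Suc k + 1) * m + (2 * t + of_bool b))"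
    by (simp add: rs_bit_def algebra_simps)
  also have "\<dots> = rudin_shapiro (2 * t + of_bool b)
      * rudin_shapiro (2 * m + (2 * t + of_bool b) div 2 ^ Suc k)"
    using assms by (intro rudin_shapiro_concat) (auto simp: of_bool_def)
  also have "(2 * t + of_bool b) div 2 ^ Suc k = t div 2 ^ k"
    by (simp add: div_mult2_eq)
  also have "t div 2 ^ k = of_bool (2 ^ k \<le> t)"
    using assms by (auto simp: of_bool_def not_le intro!: div_nat_eqI)
  finally show ?thesis by (simp add: rs_bit_def)
qed

section \<open>Cancellation under removal of digit blocks\<close>

text \<open>The state of the digit removal: \<open>b\<close> holds the digit just below each vertex
  and \<open>r\<close> the carry into it. The base points \<open>M * u w\<close> lie above the
  digits being summed, so one bound serves all boxes of side \<open>M\<close>.\<close>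

definition box_sum :: "bool list set \<Rightarrow> nat \<Rightarrow> nat \<Rightarrow> (bool list \<Rightarrow> nat) \<Rightarrow> (bool list \<Rightarrow> bool)
    \<Rightarrow> (bool list \<Rightarrow> nat) \<Rightarrow> real" where
  "box_sum W d M u b r = (\<Sum>p\<in>list_box d M. \<Prod>w\<in>W. rs_bit (b w) (M * u w + cdot w p + r w))"

text \<open>For \<open>p = Q * q + e\<close> the vertex \<open>w\<close> has low part
  \<open>cdot w e + r w\<close>. Its quotient by \<open>Q\<close> is the new carry, and
  \<open>rs_bit_concat\<close> turns its remainder into a sign and a new bit.\<close>

lemma box_sum_step:
  fixes k :: nat
  assumes W: "\<And>w. w \<in> W \<Longrightarrow> length w = d"
  defines "Q \<equiv> 2 ^ (k + 1)"
  shows "box_sum W d (Q * M) u b r = (\<Sum>e\<in>list_box d Q.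
    (\<Prod>w\<in>W. rs_bit (b w) ((cdot w e + r w) mod Q)) *
    box_sum W d M u (\<lambda>w. 2 ^ k \<le> (cdot w e + r w) mod Q) (\<lambda>w. (cdot w e + r w) div Q))"
proof -
  have "box_sum W d (Q * M) u b r = (\<Sum>e\<in>list_box d Q. \<Sum>q\<in>list_box d M.
      \<Prod>w\<in>W. rs_bit (b w) (Q * M * u w + cdot w (combine Q q e) + r w))"
    unfolding box_sum_def by (rule sum_list_box_mult) (simp add: Q_def)
  also have "\<dots> = (\<Sum>e\<in>list_box d Q. \<Sum>q\<in>list_box d M.
      \<Prod>w\<in>W. rs_bit (b w) ((cdot w e + r w) mod Q) *
        rs_bit (2 ^ k \<le> (cdot w e + r w) mod Q) (M * u w + cdot w q + (cdot w e + r w) div Q))"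
  proof (intro sum.cong prod.cong refl)
    fix e q w assume a: "e \<in> list_box d Q" "q \<in> list_box d M" "w \<in> W"
    let ?t = "cdot w e + r w"
    have "cdot w (combine Q q e) = Q * cdot w q + cdot w e"
      using a W[of w] by (subst cdot_combine) (auto simp: list_box_def)
    then have "Q * M * u w + cdot w (combine Q q e) + r w
        = Q * (M * u w + cdot w q) + (Q * (?t div Q) + ?t mod Q)"
      by (simp add: algebra_simps)
    also have "\<dots> = Q * (M * u w + cdot w q + ?t div Q) + ?t mod Q"
      by (simp add: algebra_simps)
    finally show "rs_bit (b w) (Q * M * u w + cdot w (combine Q q e) + r w)
      = rs_bit (b w) (?t mod Q) * rs_bit (2 ^ k \<le> ?t mod Q) (M * u w + cdot w q + ?t div Q)"
      unfolding Q_def by (simp only:) (rule rs_bit_concat, simp)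
  qed
  finally show ?thesis
    by (simp add: prod.distrib sum_distrib_left box_sum_def)
qed

lemma abs_prod_rs_bit [simp]: "\<bar>\<Prod>w\<in>W. rs_bit (b w) (f w)\<bar> = 1"
  by (simp add: abs_prod)

text \<open>The base points \<open>u\<close> are arbitrary: the cancellation comes from the low digits alone.\<close>

lemma box_sum_bound:
  assumes W: "\<And>w. w \<in> W \<Longrightarrow> length w = d"
    and p0: "p0 \<in> list_box d (2 ^ l)" "\<And>w. w \<in> W \<Longrightarrow> cdot w p0 < 2 ^ l"
    and neg: "(\<Prod>w\<in>W. rudin_shapiro (cdot w p0)) = -1"
    and d: "d < 2 ^ k"
  defines "Q \<equiv> 2 ^ (k + l + 2)"
  assumes r: "\<And>w. w \<in> W \<Longrightarrow> r w \<le> d"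
  shows "\<bar>box_sum W d (Q ^ L) u b r\<bar> \<le> (real Q ^ d - 2) ^ L"
  using r
proof (induction L arbitrary: b r)
  case 0
  \<comment> \<open>A box of side 1 holds one vector, whose product has absolute value 1.\<close>
  have "list_box d 1 = {replicate d 0}"
    by (force simp: list_box_def replicate_length_same[symmetric] intro!: nth_equalityI)
  then show ?case by (simp add: box_sum_def)
next
  case (Suc L)
  define K where "K = k + l + 1"
  have Q: "Q = 2 ^ (K + 1)" by (simp add: Q_def K_def)
  have Q0: "Q > 0" by (simp add: Q)
  define F where "F e = (\<Prod>w\<in>W. rs_bit (b w) ((cdot w e + r w) mod Q)) *
    box_sum W d (Q ^ L) u (\<lambda>w. 2 ^ K \<le> (cdot w e + r w) mod Q) (\<lambda>w. (cdot w e + r w) div Q)" for e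
  have S: "box_sum W d (Q ^ Suc L) u b r = (\<Sum>e\<in>list_box d Q. F e)"
    unfolding F_def Q power_Suc by (rule box_sum_step) (rule W)
  have F_le: "\<bar>F e\<bar> \<le> (real Q ^ d - 2) ^ L" if e: "e \<in> list_box d Q" for e
  proof -
    \<comment> \<open>Carries do not grow: at most \<open>d\<close> digits of size
      \<open>Q - 1\<close> and a carry \<open>d\<close> add up to \<open>d * Q\<close>.\<close>
    have "(cdot w e + r w) div Q \<le> d" if w: "w \<in> W" for w
    proof -
      have "cdot w e + r w \<le> d * (Q - 1) + d"
        using cdot_list_box_le[OF e W[OF w]] Suc.prems[OF w] by simp
      also have "\<dots> = d * Q" using Q0 by (cases Q) auto
      finally have "(cdot w e + r w) div Q \<le> (d * Q) div Q" by (rule div_le_mono)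
      then show ?thesis using Q0 by simp
    qed
    then show ?thesis
      unfolding F_def abs_mult by (simp add: Suc.IH)
  qed
  \<comment> \<open>The two digit blocks that cancel. Shifting \<open>p0\<close> by
    \<open>k + 1\<close> digits leaves \<open>k\<close> digits for the old carry, which is at most
    \<open>d < 2 ^ k\<close>, and a zero digit above them, so no block 11 joins the carry to
    \<open>p0\<close>. Everything stays below \<open>2 ^ K\<close>, so the top digit of the block is
    zero too, and both blocks pass on bit \<open>False\<close> and carry 0.\<close>
  define z where "z = replicate d (0::nat)"
  define p1 where "p1 = map ((*) (2 ^ (k + 1))) p0"
  have cz: "cdot w z = 0" for w
    unfolding z_def
  proof (induction d arbitrary: w)
    case (Suc d) then show ?case by (cases w) auto
  qed simp
  have cp1: "cdot w p1 = 2 ^ (k + 1) * cdot w p0" for w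
    unfolding p1_def by (rule cdot_map_mult)
  have z_box: "z \<in> list_box d Q" using Q0 by (auto simp: z_def list_box_def)
  have p1_box: "p1 \<in> list_box d Q"
  proof -
    have "2 ^ (k + 1) * x < Q" if "x < 2 ^ l" for x
    proof -
      have "2 ^ (k + 1) * x < 2 ^ (k + 1) * 2 ^ l" using that by simp
      also have "\<dots> \<le> Q" by (simp add: Q_def power_add)
      finally show ?thesis .
    qed
    then show ?thesis using p0(1) by (force simp: list_box_def p1_def)
  qed
  have ne: "z \<noteq> p1"
  proof
    assume "z = p1"
    then have "cdot w p0 = 0" for w using cp1[of w] cz[of w] by simp
    then show False using neg by simp
  qed
  have small: "cdot w p1 + r w < 2 ^ K" "r w < 2 ^ K" if w: "w \<in> W" for w
  proof -
    have rk: "r w < 2 ^ k" using Suc.prems[OF w] d by simp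
    have "2 ^ (k + 1) * cdot w p0 + r w < 2 ^ (k + 1) * (cdot w p0 + 1)" using rk by simp
    also have "\<dots> \<le> 2 ^ (k + 1) * 2 ^ l"
      using p0(2)[OF w] by (intro mult_le_mono2) simp
    also have "\<dots> = 2 ^ K" by (simp add: K_def power_add)
    finally show "cdot w p1 + r w < 2 ^ K" by (simp add: cp1)
    then show "r w < 2 ^ K" by simp
  qed
  have low: "\<not> 2 ^ K \<le> cdot w p1 + r w" "\<not> 2 ^ K \<le> r w" if "w \<in> W" for w
    using small[OF that] by simp_all
  have small': "(cdot w p1 + r w) div Q = 0" "(cdot w p1 + r w) mod Q = cdot w p1 + r w"
    "r w div Q = 0" "r w mod Q = r w" if w: "w \<in> W" for w
    using small[OF w] by (simp_all add: Q)
  have bs: "box_sum W d (Q ^ L) u (\<lambda>w. 2 ^ K \<le> (cdot w e + r w) mod Q) (\<lambda>w. (cdot w e + r w) div Q)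
     = box_sum W d (Q ^ L) u (\<lambda>w. False) (\<lambda>w. 0)" if "e = z \<or> e = p1" for e
    unfolding box_sum_def
    using that by (intro sum.cong prod.cong refl) (auto simp: small' cz low)
  \<comment> \<open>Splitting at the zero digit isolates the carry: its factors are those of the
    block \<open>z\<close>, and the factors of \<open>p0\<close> multiply to -1.\<close>
  have "(\<Prod>w\<in>W. rs_bit (b w) ((cdot w p1 + r w) mod Q))
      = (\<Prod>w\<in>W. rs_bit (b w) (r w) * rudin_shapiro (cdot w p0))"
  proof (intro prod.cong refl)
    fix w assume w: "w \<in> W"
    have rk: "r w < 2 ^ k" using Suc.prems[OF w] d by simp
    have "rs_bit (b w) ((cdot w p1 + r w) mod Q) = rs_bit (b w) (2 ^ (k + 1) * cdot w p0 + r w)"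
      using small'[OF w] cp1 by simp
    also have "\<dots> = rs_bit (b w) (r w) * rs_bit (2 ^ k \<le> r w) (cdot w p0)"
      using rk by (intro rs_bit_concat) simp
    finally show "rs_bit (b w) ((cdot w p1 + r w) mod Q) = rs_bit (b w) (r w) * rudin_shapiro (cdot w p0)"
      using rk by (simp add: not_le)
  qed
  also have "\<dots> = - (\<Prod>w\<in>W. rs_bit (b w) ((cdot w z + r w) mod Q))"
    using neg by (simp add: prod.distrib cz small' cong: prod.cong)
  finally have cancel: "F z + F p1 = 0"
    unfolding F_def using bs by simp
  have "(\<Sum>e\<in>list_box d Q. F e) = (\<Sum>e\<in>list_box d Q - {z, p1}. F e) + (\<Sum>e\<in>{z, p1}. F e)"
    using z_box p1_box by (intro sum.subset_diff) auto
  also have "(\<Sum>e\<in>{z, p1}. F e) = 0" using ne cancel by simp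
  finally have "\<bar>box_sum W d (Q ^ Suc L) u b r\<bar> \<le> (\<Sum>e\<in>list_box d Q - {z, p1}. \<bar>F e\<bar>)"
    unfolding S by simp
  also have "\<dots> \<le> real (card (list_box d Q - {z, p1})) * (real Q ^ d - 2) ^ L"
    using F_le by (intro sum_bounded_above) auto
  also have "real (card (list_box d Q - {z, p1})) = real Q ^ d - 2"
  proof -
    have c2: "card {z, p1} = 2" using ne by simp
    have "2 \<le> card (list_box d Q)"
      using card_mono[of "list_box d Q" "{z, p1}"] z_box p1_box unfolding c2 by simp
    then show ?thesis
      using z_box p1_box c2 by (subst card_Diff_subset) (auto simp: card_list_box)
  qed
  finally show ?case by simp
qed

section \<open>A cube with product -1\<close>

lemma omegas_0: "omegas 0 = {[]}"
  by (auto simp: omegas_def)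

lemma omegas_Suc: "omegas (Suc s) = Cons True ` omegas s \<union> Cons False ` omegas s"
proof -
  have "w \<in> Cons True ` omegas s \<union> Cons False ` omegas s" if "length w = Suc s" for w
    using that by (cases w; cases "hd w") (auto simp: omegas_def)
  then show ?thesis by (auto simp: omegas_def)
qed

lemma finite_omegas [simp]: "finite (omegas s)"
  by (induction s) (auto simp: omegas_0 omegas_Suc)

lemma card_omegas: "card (omegas s) = 2 ^ s"
proof (induction s)
  case (Suc s)
  then show ?case unfolding omegas_Suc
    by (subst card_Un_disjoint) (auto simp: card_image)
qed (simp add: omegas_0)

lemma prod_omegas_Suc:
  "(\<Prod>w\<in>omegas (Suc s). f w) = (\<Prod>w\<in>omegas s. f (True # w)) * (\<Prod>w\<in>omegas s. f (False # w))"
  unfolding omegas_Suc by (subst prod.union_disjoint) (auto simp: prod.reindex)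

text \<open>Prepending the step \<open>2 ^ m\<close> multiplies the products based at
  \<open>n\<close> and at \<open>n + 2 ^ m\<close>. Their common factor \<open>f (n + 2 ^ m)\<close>
  occurs squared and drops out, so the gap doubles.\<close>

lemma exists_cube_steps:
  fixes f :: "nat \<Rightarrow> real"
  assumes f: "\<And>n. f n * f n = 1"
  shows "\<exists>h. length h = Suc m \<and> (\<forall>n. (\<Prod>w\<in>omegas (Suc m). f (n + cdot w h)) = f n * f (n + 2 ^ m))"
proof (induction m)
  case 0
  show ?case by (intro exI[of _ "[1]"]) (auto simp: prod_omegas_Suc omegas_0 omegas_Suc)
next
  case (Suc m)
  then obtain h where h: "length h = Suc m"
    "\<And>n. (\<Prod>w\<in>omegas (Suc m). f (n + cdot w h)) = f n * f (n + 2 ^ m)" by blast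
  have "(\<Prod>w\<in>omegas (Suc (Suc m)). f (n + cdot w (2 ^ m # h))) = f n * f (n + 2 ^ Suc m)" for n
  proof -
    have "(\<Prod>w\<in>omegas (Suc (Suc m)). f (n + cdot w (2 ^ m # h)))
        = (\<Prod>w\<in>omegas (Suc m). f (n + 2 ^ m + cdot w h)) * (\<Prod>w\<in>omegas (Suc m). f (n + cdot w h))"
      unfolding prod_omegas_Suc[of _ "Suc m"] by (simp add: add.assoc)
    also have "\<dots> = f n * f (n + 2 ^ Suc m) * (f (n + 2 ^ m) * f (n + 2 ^ m))"
      unfolding h by (simp add: mult_2 algebra_simps)
    finally show ?thesis by (simp add: f)
  qed
  then show ?case using h(1) by (intro exI[of _ "2 ^ m # h"]) auto
qed

lemma exists_negative_cube:
  assumes "s \<ge> 1"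
  shows "\<exists>p. length p = Suc s \<and> (\<Prod>w\<in>Cons True ` omegas s. rudin_shapiro (cdot w p)) = -1"
proof -
  obtain m where m: "s = Suc m" using assms by (cases s) auto
  obtain h where h: "length h = Suc m" "\<And>n. (\<Prod>w\<in>omegas (Suc m). rudin_shapiro (n + cdot w h))
      = rudin_shapiro n * rudin_shapiro (n + 2 ^ m)"
    using exists_cube_steps[of rudin_shapiro m] by auto
  \<comment> \<open>The base point makes the two surviving arguments \<open>2 ^ (m + 1)\<close> and
    \<open>3 * 2 ^ m\<close>, with binary expansions 10...0 and 110...0.\<close>
  have "(\<Prod>w\<in>Cons True ` omegas s. rudin_shapiro (cdot w (2 ^ Suc m # h)))
      = rudin_shapiro (2 ^ Suc m) * rudin_shapiro (2 ^ Suc m + 2 ^ m)"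
    using h(2) by (subst prod.reindex) (auto simp: m)
  also have "\<dots> = rudin_shapiro (2 ^ Suc m * 1) * rudin_shapiro (2 ^ m * 3)"
    by (simp add: mult.commute)
  also have "\<dots> = -1" by (simp only: rudin_shapiro_power2_mult) (simp add: rudin_shapiro_3)
  finally show ?thesis using h(1) m by (intro exI[of _ "2 ^ Suc m # h"]) auto
qed

section \<open>Cubes in [N] and their decomposition into boxes\<close>

text \<open>Base point and steps form one list, so a vertex is a single subset sum with leading
  coefficient \<open>True\<close>, and the digits of all coordinates can be removed
  together.\<close>

definition cube_lists :: "nat \<Rightarrow> nat \<Rightarrow> int list set" where
  "cube_lists s N = {p. length p = Suc s \<and>
    (\<forall>w\<in>Cons True ` omegas s. 0 \<le> cdot w p \<and> cdot w p < int N)}"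

lemma bij_betw_cubes: "bij_betw (\<lambda>(n, h). n # h) (cubes s N) (cube_lists s N)"
proof (rule bij_betwI[where g = "\<lambda>p. (hd p, tl p)"])
  show "(\<lambda>(n, h). n # h) \<in> cubes s N \<rightarrow> cube_lists s N"
    by (auto simp: cubes_def cube_lists_def cube_dot_eq_cdot)
  show "(\<lambda>p. (hd p, tl p)) \<in> cube_lists s N \<rightarrow> cubes s N"
  proof
    fix p assume p: "p \<in> cube_lists s N"
    then obtain n h where "p = n # h" by (cases p) (auto simp: cube_lists_def)
    then show "(hd p, tl p) \<in> cubes s N"
      using p by (auto simp: cubes_def cube_lists_def cube_dot_eq_cdot)
  qed
  show "(hd (case x of (n, h) \<Rightarrow> n # h), tl (case x of (n, h) \<Rightarrow> n # h)) = x" for x :: "int \<times> int list"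
    by (cases x) auto
  show "p \<in> cube_lists s N \<Longrightarrow> (case (hd p, tl p) of (n, h) \<Rightarrow> n # h) = p" for p
    by (cases p) (auto simp: cube_lists_def)
qed

lemma gowers_pow_eq:
  "gowers_pow s N f = (\<Sum>p\<in>cube_lists s N. \<Prod>w\<in>Cons True ` omegas s. f (nat (cdot w p)))
    / real (card (cube_lists s N))"
proof -
  have "(\<Sum>(n, h)\<in>cubes s N. \<Prod>w\<in>omegas s. f (nat (n + cube_dot w h)))
      = (\<Sum>(n, h)\<in>cubes s N. \<Prod>w\<in>Cons True ` omegas s. f (nat (cdot w (n # h))))"
    by (subst prod.reindex) (auto simp: cube_dot_eq_cdot)
  also have "\<dots> = (\<Sum>x\<in>cubes s N. \<Prod>w\<in>Cons True ` omegas s. f (nat (cdot w ((\<lambda>(n, h). n # h) x))))"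
    by (intro sum.cong) auto
  also have "\<dots> = (\<Sum>p\<in>cube_lists s N. \<Prod>w\<in>Cons True ` omegas s. f (nat (cdot w p)))"
    by (rule sum.reindex_bij_betw[OF bij_betw_cubes])
  finally show ?thesis
    by (simp add: gowers_pow_def bij_betw_same_card[OF bij_betw_cubes])
qed

lemma cdot_zero_vector: "\<exists>w\<in>omegas (length h). cdot w h = (0::'a::comm_monoid_add)"
proof (induction h)
  case (Cons x h)
  then obtain w where "w \<in> omegas (length h)" "cdot w h = 0" by blast
  then show ?case by (intro bexI[of _ "False # w"]) (auto simp: omegas_def)
qed (simp add: omegas_def)

lemma cdot_unit_vector:
  "x \<in> set h \<Longrightarrow> \<exists>w\<in>omegas (length h). cdot w h = (x::'a::comm_monoid_add)"
proof (induction h)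
  case (Cons y h)
  show ?case
  proof (cases "x = y")
    case True
    obtain w where "w \<in> omegas (length h)" "cdot w h = 0" using cdot_zero_vector[of h] by blast
    then show ?thesis using True by (intro bexI[of _ "True # w"]) (auto simp: omegas_def)
  next
    case False
    then obtain w where "w \<in> omegas (length h)" "cdot w h = x" using Cons by auto
    then show ?thesis by (intro bexI[of _ "False # w"]) (auto simp: omegas_def)
  qed
qed simp

text \<open>A step \<open>x\<close> is the difference of the vertices \<open>n + x\<close> and
  \<open>n\<close>, both in [N].\<close>

lemma cube_lists_steps:
  assumes "n # h \<in> cube_lists s N"
  shows "set h \<subseteq> {- int N<..<int N}" "length h = s"
proof -
  show l: "length h = s" using assms by (simp add: cube_lists_def)
  have b: "0 \<le> n + cdot w h \<and> n + cdot w h < int N" if "w \<in> omegas s" for w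
    using assms that by (auto simp: cube_lists_def)
  show "set h \<subseteq> {- int N<..<int N}"
  proof
    fix x assume "x \<in> set h"
    then obtain w where "w \<in> omegas s" "cdot w h = x" using cdot_unit_vector l by metis
    moreover obtain w' where "w' \<in> omegas s" "cdot w' h = 0" using cdot_zero_vector[of h] l by auto
    ultimately show "x \<in> {- int N<..<int N}" using b[of w] b[of w'] by auto
  qed
qed

definition step_lists :: "nat \<Rightarrow> nat \<Rightarrow> int list set" where
  "step_lists s N = {h. set h \<subseteq> {- int N<..<int N} \<and> length h = s}"

lemma finite_step_lists [simp]: "finite (step_lists s N)"
  unfolding step_lists_def by (rule finite_lists_length_eq) simp

lemma card_step_lists_le: "card (step_lists s N) \<le> (2 * N) ^ s"
proof -
  have "card (step_lists s N) = card {- int N<..<int N} ^ s"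
    unfolding step_lists_def by (rule card_lists_length_eq) simp
  also have "\<dots> \<le> (2 * N) ^ s" by (intro power_mono) auto
  finally show ?thesis .
qed

lemma finite_cube_lists [simp]: "finite (cube_lists s N)"
proof -
  have "cube_lists s N \<subseteq> (\<lambda>(n, h). n # h) ` ({0..<int N} \<times> step_lists s N)"
  proof
    fix p assume p: "p \<in> cube_lists s N"
    then obtain n h where ph: "p = n # h" by (cases p) (auto simp: cube_lists_def)
    obtain w where "w \<in> omegas s" "cdot w h = 0"
      using cdot_zero_vector[of h] cube_lists_steps(2) p ph by blast
    then have "n \<in> {0..<int N}" using p by (force simp: ph cube_lists_def)
    then show "p \<in> (\<lambda>(n, h). n # h) ` ({0..<int N} \<times> step_lists s N)"
      using p cube_lists_steps[of n h s N] by (auto simp: ph step_lists_def)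
  qed
  then show ?thesis by (rule finite_subset) auto
qed

text \<open>Nonnegative vectors with entries below \<open>N div Suc s\<close> are cubes in [N],
  because a vertex is a sum of at most \<open>s + 1\<close> entries.\<close>

lemma card_cube_lists_ge: "(N div Suc s) ^ Suc s \<le> card (cube_lists s N)"
proof -
  let ?k = "N div Suc s"
  have "map int p \<in> cube_lists s N" if p: "p \<in> list_box (Suc s) ?k" for p
  proof -
    have "p \<noteq> []" using p by (auto simp: list_box_def)
    then have k: "?k > 0" using p by (cases p) (auto simp: list_box_def)
    have "cdot w p < N" if "length w = Suc s" for w
    proof -
      have "cdot w p \<le> Suc s * (?k - 1)" using cdot_list_box_le[OF p that] .
      also have "\<dots> < Suc s * ?k" using k by (intro mult_strict_left_mono) auto
      also have "\<dots> \<le> N" by (rule times_div_less_eq_dividend)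
      finally show ?thesis .
    qed
    then show ?thesis
      using p by (auto simp: cube_lists_def list_box_def omegas_def cdot_map_of_nat simp del: cdot_Cons)
  qed
  then have "map int ` list_box (Suc s) ?k \<subseteq> cube_lists s N" by blast
  then have "card (map int ` list_box (Suc s) ?k) \<le> card (cube_lists s N)"
    by (intro card_mono) auto
  also have "card (map int ` list_box (Suc s) ?k) = ?k ^ Suc s"
    by (subst card_image) (simp_all add: card_list_box inj_on_def)
  finally show ?thesis .
qed

text \<open>The corners (divided by \<open>M\<close>) of the boxes of side \<open>M\<close> that consist of cubes in \<open>[N]\<close> only.\<close>

definition good_roots :: "nat \<Rightarrow> nat \<Rightarrow> nat \<Rightarrow> int list set" where
  "good_roots s N M = {q. length q = Suc s \<and>
    (\<forall>e\<in>list_box (Suc s) M. combine (int M) q e \<in> cube_lists s N)}"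

definition good_cubes :: "nat \<Rightarrow> nat \<Rightarrow> nat \<Rightarrow> int list set" where
  "good_cubes s N M = (\<lambda>(q, e). combine (int M) q e) ` (good_roots s N M \<times> list_box (Suc s) M)"

lemma inj_on_combine:
  "inj_on (\<lambda>(q, e). combine (int M) q e) (good_roots s N M \<times> list_box (Suc s) M)"
proof (rule inj_on_inverseI[where g = "\<lambda>p. (map (\<lambda>x. x div int M) p, map (\<lambda>x. nat (x mod int M)) p)"])
  fix x assume "x \<in> good_roots s N M \<times> list_box (Suc s) M"
  then obtain q e where x: "x = (q, e)" and "length q = length e" "set e \<subseteq> {0..<M}"
    by (auto simp: good_roots_def list_box_def)
  then show "(map (\<lambda>x. x div int M) (case x of (q, e) \<Rightarrow> combine (int M) q e),
     map (\<lambda>x. nat (x mod int M)) (case x of (q, e) \<Rightarrow> combine (int M) q e)) = x"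
    using combine_div_mod_int[of q e M] by simp
qed

lemma good_cubes_subset: "good_cubes s N M \<subseteq> cube_lists s N"
  by (auto simp: good_cubes_def good_roots_def)

lemma card_good_cubes: "card (good_cubes s N M) = card (good_roots s N M) * M ^ Suc s"
  unfolding good_cubes_def by (simp only: card_image[OF inj_on_combine] card_cartesian_product card_list_box)

text \<open>If the box of \<open>p\<close> is incomplete, some vector in it has a vertex outside
  [N]. The same vertex \<open>v\<close> of \<open>p\<close> lies in [N], and the two differ by less
  than \<open>Suc s * M\<close>, so \<open>v\<close> is that close to an end of [N]. The index
  \<open>w\<close>, the value \<open>v\<close> and the steps \<open>h\<close> determine
  \<open>p\<close>.\<close>

lemma bad_cubes_subset:
  assumes "M > 0"
  shows "cube_lists s N - good_cubes s N M \<subseteq>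
    (\<Union>w\<in>omegas s. (\<lambda>(v, h). (v - cdot w h) # h) `
      (({0..<int (Suc s * M)} \<union> {int N - int (Suc s * M)..<int N}) \<times> step_lists s N))"
    (is "_ \<subseteq> (\<Union>w\<in>_. _ ` (?T \<times> _))")
proof
  fix p assume p: "p \<in> cube_lists s N - good_cubes s N M"
  define q where "q = map (\<lambda>x. x div int M) p"
  define e where "e = map (\<lambda>x. nat (x mod int M)) p"
  have len: "length q = Suc s" using p by (simp add: q_def cube_lists_def)
  have e: "e \<in> list_box (Suc s) M"
    using p assms by (auto simp: e_def list_box_def cube_lists_def nat_less_iff)
  have peq: "p = combine (int M) q e"
    unfolding q_def e_def using combine_of_div_mod_int[OF assms] by simp
  have "q \<notin> good_roots s N M"
  proof
    assume "q \<in> good_roots s N M"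
    then have "p \<in> good_cubes s N M" unfolding good_cubes_def peq using e by force
    then show False using p by simp
  qed
  then obtain e' where e': "e' \<in> list_box (Suc s) M" "combine (int M) q e' \<notin> cube_lists s N"
    using len by (auto simp: good_roots_def)
  have len': "length (combine (int M) q e') = Suc s" using len e' by (simp add: list_box_def)
  obtain w where w: "w \<in> omegas s" and out:
    "\<not> (0 \<le> cdot (True # w) (combine (int M) q e') \<and> cdot (True # w) (combine (int M) q e') < int N)"
    using e'(2) len' unfolding cube_lists_def by blast
  have lw: "length (True # w) = Suc s" using w by (simp add: omegas_def)
  define v where "v = cdot (True # w) p"
  have v: "v = int M * cdot (True # w) q + int (cdot (True # w) e)"
    unfolding v_def peq using len lw e by (subst cdot_combine) (auto simp: list_box_def)
  have v': "cdot (True # w) (combine (int M) q e') = int M * cdot (True # w) q + int (cdot (True # w) e')"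
    using len lw e' by (subst cdot_combine) (auto simp: list_box_def)
  have lt: "cdot (True # w) a < Suc s * M" if "a \<in> list_box (Suc s) M" for a
  proof -
    have "cdot (True # w) a \<le> Suc s * (M - 1)" by (rule cdot_list_box_le[OF that lw])
    also have "\<dots> < Suc s * M" using assms by (intro mult_strict_left_mono) auto
    finally show ?thesis .
  qed
  have "0 \<le> v" "v < int N"
    using p w unfolding v_def cube_lists_def by blast+
  then have vT: "v \<in> ?T"
    using out lt[OF e] lt[OF e'(1)] unfolding v v' Un_iff atLeastLessThan_iff by linarith
  obtain n h where ph: "p = n # h" using p by (cases p) (auto simp: cube_lists_def)
  have "h \<in> step_lists s N"
    using p cube_lists_steps[of n h s N] by (auto simp: ph step_lists_def)
  moreover have "p = (v - cdot w h) # h" by (simp add: v_def ph)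
  ultimately have "p \<in> (\<lambda>(v, h). (v - cdot w h) # h) ` (?T \<times> step_lists s N)"
    using vT by force
  then show "p \<in> (\<Union>w\<in>omegas s. (\<lambda>(v, h). (v - cdot w h) # h) ` (?T \<times> step_lists s N))"
    using w by blast
qed

lemma card_bad_cubes_le:
  assumes "M > 0"
  shows "card (cube_lists s N - good_cubes s N M) \<le> 2 ^ s * (2 * (Suc s * M) * (2 * N) ^ s)"
proof -
  let ?T = "{0..<int (Suc s * M)} \<union> {int N - int (Suc s * M)..<int N}"
  let ?B = "\<lambda>w. (\<lambda>(v, h). (v - cdot w h) # h) ` (?T \<times> step_lists s N)"
  have "card (cube_lists s N - good_cubes s N M) \<le> card (\<Union>w\<in>omegas s. ?B w)"
    by (rule card_mono[OF _ bad_cubes_subset[OF assms]]) auto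
  also have "\<dots> \<le> (\<Sum>w\<in>omegas s. card (?B w))"
    by (rule card_UN_le) simp
  also have "\<dots> \<le> of_nat (card (omegas s)) * (2 * (Suc s * M) * (2 * N) ^ s)"
  proof (rule sum_bounded_above)
    fix w
    have "card ?T \<le> card {0..<int (Suc s * M)} + card {int N - int (Suc s * M)..<int N}"
      by (rule card_Un_le)
    also have "\<dots> = 2 * (Suc s * M)" by (simp del: of_nat_mult mult_Suc) simp
    finally have T: "card ?T \<le> 2 * (Suc s * M)" .
    have "card (?B w) \<le> card (?T \<times> step_lists s N)" by (rule card_image_le) simp
    also have "\<dots> = card ?T * card (step_lists s N)" by (rule card_cartesian_product)
    also have "\<dots> \<le> 2 * (Suc s * M) * (2 * N) ^ s"
      by (intro mult_le_mono T card_step_lists_le)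
    finally show "card (?B w) \<le> 2 * (Suc s * M) * (2 * N) ^ s" .
  qed
  finally show ?thesis by (simp add: card_omegas)
qed

text \<open>For a fixed corner \<open>q\<close>, the sum over \<open>e\<close> is a
  \<open>box_sum\<close> in the initial state (bits \<open>False\<close>, carries 0) with base
  points given by \<open>cdot w q\<close>; the uniformity of \<open>B\<close> in \<open>u\<close>
  covers every corner.\<close>

lemma good_cubes_sum_bound:
  assumes "M > 0" and B: "\<And>u. \<bar>box_sum (Cons True ` omegas s) (Suc s) M u (\<lambda>_. False) (\<lambda>_. 0)\<bar> \<le> B"
  shows "\<bar>\<Sum>p\<in>good_cubes s N M. \<Prod>w\<in>Cons True ` omegas s. rudin_shapiro (nat (cdot w p))\<bar>
    \<le> real (card (good_roots s N M)) * B"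
proof -
  let ?W = "Cons True ` omegas s"
  have "(\<Sum>p\<in>good_cubes s N M. \<Prod>w\<in>?W. rudin_shapiro (nat (cdot w p)))
     = (\<Sum>(q, e)\<in>good_roots s N M \<times> list_box (Suc s) M.
         \<Prod>w\<in>?W. rudin_shapiro (nat (cdot w (combine (int M) q e))))"
    unfolding good_cubes_def by (subst sum.reindex[OF inj_on_combine]) (auto intro!: sum.cong)
  also have "\<dots> = (\<Sum>q\<in>good_roots s N M. \<Sum>e\<in>list_box (Suc s) M.
         \<Prod>w\<in>?W. rudin_shapiro (nat (cdot w (combine (int M) q e))))"
    by (simp add: sum.cartesian_product)
  also have "\<dots> = (\<Sum>q\<in>good_roots s N M.
      box_sum ?W (Suc s) M (\<lambda>w. nat (cdot w q)) (\<lambda>_. False) (\<lambda>_. 0))"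
    unfolding box_sum_def
  proof (intro sum.cong prod.cong refl)
    fix q e w assume q: "q \<in> good_roots s N M" and e: "e \<in> list_box (Suc s) M" and w: "w \<in> ?W"
    have lw: "length w = Suc s" using w by (auto simp: omegas_def)
    have c: "cdot w (combine (int M) q a) = int M * cdot w q + int (cdot w a)"
      if "a \<in> list_box (Suc s) M" for a
      using q that lw by (subst cdot_combine) (auto simp: good_roots_def list_box_def)
    \<comment> \<open>The corner itself, with all digits 0, is a cube in [N]. Hence
      \<open>M * cdot w q\<close> is nonnegative and \<open>nat\<close> distributes over the
      sum.\<close>
    define z where "z = replicate (Suc s) (0::nat)"
    have z: "z \<in> list_box (Suc s) M" using assms(1) by (auto simp: z_def list_box_def)
    have "cdot w z \<le> length z * 0" using lw by (intro cdot_le) (auto simp: z_def)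
    then have "cdot w z = 0" by simp
    moreover have "combine (int M) q z \<in> cube_lists s N"
      using q z unfolding good_roots_def by blast
    then have "0 \<le> cdot w (combine (int M) q z)"
      using w unfolding cube_lists_def by blast
    ultimately have "0 \<le> int M * cdot w q"
      using c[OF z] by simp
    then have "0 \<le> cdot w q" using assms(1) by (simp add: zero_le_mult_iff)
    then have "nat (cdot w (combine (int M) q e)) = M * nat (cdot w q) + cdot w e"
      unfolding c[OF e] by (simp add: nat_add_distrib nat_mult_distrib)
    then show "rudin_shapiro (nat (cdot w (combine (int M) q e)))
        = rs_bit False (M * nat (cdot w q) + cdot w e + 0)" by simp
  qed
  finally have "\<bar>\<Sum>p\<in>good_cubes s N M. \<Prod>w\<in>?W. rudin_shapiro (nat (cdot w p))\<bar>
     \<le> (\<Sum>q\<in>good_roots s N M. \<bar>box_sum ?W (Suc s) M (\<lambda>w. nat (cdot w q)) (\<lambda>_. False) (\<lambda>_. 0)\<bar>)"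
    by simp
  also have "\<dots> \<le> real (card (good_roots s N M)) * B"
    using B by (intro sum_bounded_above) auto
  finally show ?thesis .
qed

section \<open>From box sums to a power saving\<close>

text \<open>The full boxes are disjoint sets of cubes, so they contribute at most
  \<open>B / M ^ Suc s\<close> to the average. Incomplete boxes hold O(M N^s) cubes, while the total
  is at least of order N^(s+1); this gives the term \<open>M / N\<close>.\<close>

lemma gowers_pow_block_bound:
  fixes B :: real
  assumes M: "M > 0" and N: "N \<ge> Suc s"
    and B: "\<And>u. \<bar>box_sum (Cons True ` omegas s) (Suc s) M u (\<lambda>_. False) (\<lambda>_. 0)\<bar> \<le> B"
  shows "\<bar>gowers_pow s N rudin_shapiro\<bar>
    \<le> B / real M ^ Suc s + 4 ^ Suc s * (2 * real (Suc s)) ^ (s + 2) * (real M / real N)"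
proof -
  let ?W = "Cons True ` omegas s"
  let ?F = "\<lambda>p. \<Prod>w\<in>?W. rudin_shapiro (nat (cdot w p))"
  let ?C = "cube_lists s N" and ?G = "good_cubes s N M"
  have B0: "0 \<le> B" using B[of undefined] by linarith
  \<comment> \<open>As \<open>N div Suc s\<close> is at least 1, rounding down costs at most a
    factor 2.\<close>
  have "real N / (2 * real (Suc s)) \<le> real (N div Suc s)"
  proof -
    have "N div Suc s \<ge> 1" using N by (simp add: Suc_le_eq div_greater_zero_iff)
    moreover have "N < Suc s * (N div Suc s + 1)"
      using dividend_less_div_times[of "Suc s" N] by (simp add: algebra_simps)
    moreover have "Suc s * (N div Suc s + 1) \<le> Suc s * (2 * (N div Suc s))"
      using calculation(1) by (intro mult_le_mono2) simp
    ultimately have "N \<le> Suc s * (2 * (N div Suc s))" by linarith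
    then have "real N \<le> real (Suc s * (2 * (N div Suc s)))" by (rule of_nat_mono)
    then show ?thesis by (simp add: field_simps)
  qed
  then have "(real N / (2 * real (Suc s))) ^ Suc s \<le> real (N div Suc s) ^ Suc s"
    by (intro power_mono) auto
  also have "\<dots> \<le> real (card ?C)"
    using card_cube_lists_ge[of N s] by (metis of_nat_le_iff of_nat_power)
  finally have Cge: "(real N / (2 * real (Suc s))) ^ Suc s \<le> real (card ?C)" .
  have N0: "real N > 0" using N by simp
  then have C0: "real (card ?C) > 0"
    by (intro less_le_trans[OF _ Cge] zero_less_power divide_pos_pos) auto
  have "(\<Sum>p\<in>?C. ?F p) = (\<Sum>p\<in>?C - ?G. ?F p) + (\<Sum>p\<in>?G. ?F p)"
    by (intro sum.subset_diff good_cubes_subset) simp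
  moreover have "\<bar>\<Sum>p\<in>?C - ?G. ?F p\<bar> \<le> (\<Sum>p\<in>?C - ?G. \<bar>?F p\<bar>)" by (rule sum_abs)
  moreover have "(\<Sum>p\<in>?C - ?G. \<bar>?F p\<bar>) = real (card (?C - ?G))"
    by (simp add: abs_prod)
  ultimately have "\<bar>\<Sum>p\<in>?C. ?F p\<bar> \<le> real (card (?C - ?G)) + real (card (good_roots s N M)) * B"
    using good_cubes_sum_bound[OF M B, of N] by linarith
  then have 1: "\<bar>gowers_pow s N rudin_shapiro\<bar>
      \<le> real (card (good_roots s N M)) * B / real (card ?C) + real (card (?C - ?G)) / real (card ?C)"
    unfolding gowers_pow_eq using C0 by (simp add: field_simps)
  have "real (card (good_roots s N M)) * real M ^ Suc s = real (card ?G)"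
    by (simp add: card_good_cubes)
  also have "\<dots> \<le> real (card ?C)"
    using card_mono[OF finite_cube_lists good_cubes_subset] by simp
  finally have "real (card (good_roots s N M)) * real M ^ Suc s * B \<le> real (card ?C) * B"
    using B0 by (rule mult_right_mono)
  then have 2: "real (card (good_roots s N M)) * B / real (card ?C) \<le> B / real M ^ Suc s"
    using C0 M by (simp add: field_simps)
  have four: "(4::real) ^ s = 2 ^ s * 2 ^ s"
    by (simp flip: power_mult_distrib)
  have "real (card (?C - ?G)) \<le> real (2 ^ s * (2 * (Suc s * M) * (2 * N) ^ s))"
    by (rule of_nat_mono[OF card_bad_cubes_le[OF M]])
  also have "\<dots> = 4 ^ s * (2 * real (Suc s)) * real M * real N ^ s"
    by (simp only: of_nat_mult of_nat_power of_nat_numeral power_mult_distrib four) (simp only: mult_ac)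
  finally have "real (card (?C - ?G)) / real (card ?C)
      \<le> (4 ^ s * (2 * real (Suc s)) * real M * real N ^ s) / (real N / (2 * real (Suc s))) ^ Suc s"
    using Cge N0 by (intro frac_le) auto
  also have "\<dots> = 4 ^ s * (2 * real (Suc s)) ^ (s + 2) * (real M / real N)"
  proof -
    have "a * D * m * n ^ s / (n / D) ^ Suc s = a * D ^ (s + 2) * (m / n)"
      if "n > 0" "D > 0" for a D m n :: real
      using that by (simp add: divide_simps)
    then show ?thesis using N0 by (simp only: of_nat_0_less_iff zero_less_Suc zero_less_mult_iff zero_less_numeral simp_thms)
  qed
  also have "\<dots> \<le> 4 ^ Suc s * (2 * real (Suc s)) ^ (s + 2) * (real M / real N)"
    by (intro mult_right_mono power_increasing) auto
  finally show ?thesis using 1 2 by linarith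
qed

lemma cdot_le_sum_list: "cdot w p \<le> sum_list (p :: nat list)"
proof (induction w arbitrary: p)
  case (Cons b w)
  show ?case
  proof (cases p)
    case (Cons x p')
    then show ?thesis using Cons.IH[of p'] by (auto intro: le_SucI add_increasing)
  qed simp
qed simp

lemma box_sum_power_saving:
  assumes "s \<ge> 1"
  shows "\<exists>Q. Q > 1 \<and> real Q ^ Suc s > 2 \<and> (\<forall>L u.
    \<bar>box_sum (Cons True ` omegas s) (Suc s) (Q ^ L) u (\<lambda>_. False) (\<lambda>_. 0)\<bar> \<le> (real Q ^ Suc s - 2) ^ L)"
proof -
  obtain p where p: "length p = Suc s"
    "(\<Prod>w\<in>Cons True ` omegas s. rudin_shapiro (cdot w p)) = -1"
    using exists_negative_cube[OF assms] by blast
  \<comment> \<open>The sum of the entries bounds every entry and every vertex of the negative cube,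
    and \<open>l < 2 ^ l\<close>. The exponent of \<open>Q\<close> is the one in
    \<open>box_sum_bound\<close> for \<open>k = d = Suc s\<close>.\<close>
  define l where "l = sum_list p"
  define Q :: nat where "Q = 2 ^ (Suc s + l + 2)"
  have lt: "x \<le> l \<Longrightarrow> x < 2 ^ l" for x
    using less_exp[of l] by linarith
  have "p \<in> list_box (Suc s) (2 ^ l)"
    using p(1) member_le_sum_list[of _ p] by (auto simp: list_box_def l_def[symmetric] intro!: lt)
  then have "\<bar>box_sum (Cons True ` omegas s) (Suc s) (Q ^ L) u (\<lambda>_. False) (\<lambda>_. 0)\<bar>
      \<le> (real Q ^ Suc s - 2) ^ L" for L u
    unfolding Q_def using p(2) cdot_le_sum_list[of _ p] less_exp[of "Suc s"]
    by (intro box_sum_bound[where ?p0.0 = p]) (auto simp: omegas_def l_def[symmetric] simp del: cdot_Cons intro!: lt)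
  moreover have Q4: "4 \<le> Q" by (simp add: Q_def power_add)
  moreover have "real Q \<le> real Q ^ Suc s"
    using Q4 power_increasing[of 1 "Suc s" "real Q"] by simp
  then have "2 < real Q ^ Suc s" using Q4 by linarith
  ultimately show ?thesis by (intro exI[of _ Q]) auto
qed

text \<open>Take \<open>M = Q ^ L\<close> of order sqrt N. Then the box average is at most
  \<open>\<rho> ^ L\<close> with \<open>L\<close> of order log N, hence a negative power of N, and
  the boundary term satisfies \<open>M / N\<close> \<le> N^(-1/2).\<close>

lemma gowers_pow_rudin_shapiro_bound:
  assumes "s \<ge> 1"
  shows "\<exists>c>0. \<exists>C>0. \<forall>N\<ge>Suc s. \<bar>gowers_pow s N rudin_shapiro\<bar> \<le> C * real N powr (-c)"
proof -
  obtain Q where Q: "Q > 1" "real Q ^ Suc s > 2" and B: "\<And>L u.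
    \<bar>box_sum (Cons True ` omegas s) (Suc s) (Q ^ L) u (\<lambda>_. False) (\<lambda>_. 0)\<bar> \<le> (real Q ^ Suc s - 2) ^ L"
    using box_sum_power_saving[OF assms] by blast
  define \<rho> where "\<rho> = (real Q ^ Suc s - 2) / real Q ^ Suc s"
  define R where "R = real (Q ^ 2)"
  have Q2: "Q ^ 2 \<ge> 2" using Q(1) by (metis Suc_1 Suc_leI one_less_power zero_less_numeral)
  then have R: "R > 1" unfolding R_def by linarith
  have rho: "0 < \<rho>" "\<rho> < 1" using Q by (auto simp: \<rho>_def divide_simps)
  \<comment> \<open>Since N ranges over intervals from \<open>R ^ L\<close> to
    \<open>R ^ (L + 1)\<close>, logarithms to base \<open>R\<close> convert decay in
    \<open>L\<close> into decay in N.\<close>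
  define \<delta> where "\<delta> = - log R \<rho>"
  have delta: "\<delta> > 0" using rho R by (simp add: \<delta>_def)
  have rho_eq: "\<rho> = R powr (-\<delta>)" using rho R by (simp add: \<delta>_def)
  define A where "A = 4 ^ Suc s * (2 * real (Suc s)) ^ (s + 2)"
  define c where "c = min \<delta> (1/2)"
  have A: "A > 0" by (simp add: A_def)
  have "\<bar>gowers_pow s N rudin_shapiro\<bar> \<le> (1 / \<rho> + A) * real N powr (-c)" if N: "N \<ge> Suc s" for N
  proof -
    have N1: "real N \<ge> 1" using N by simp
    obtain L where L: "(Q ^ 2) ^ L \<le> N" "N < (Q ^ 2) ^ (L + 1)"
      using ex_power_ivl1[OF Q2, of N] N by auto
    define M where "M = Q ^ L"
    have M: "M > 0" using Q by (simp add: M_def)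
    have "\<bar>gowers_pow s N rudin_shapiro\<bar> \<le> (real Q ^ Suc s - 2) ^ L / real M ^ Suc s + A * (real M / real N)"
      unfolding A_def by (intro gowers_pow_block_bound M N) (simp only: M_def B)
    also have "real M ^ Suc s = (real Q ^ Suc s) ^ L"
      by (simp only: M_def of_nat_power power_mult[symmetric] mult.commute)
    also have "(real Q ^ Suc s - 2) ^ L / (real Q ^ Suc s) ^ L = \<rho> ^ L"
      by (simp only: \<rho>_def power_divide)
    also have "\<rho> ^ L \<le> 1 / \<rho> * real N powr (-c)"
    proof -
      \<comment> \<open>N is bounded above by the power \<open>L + 1\<close>, so the decay comes out
        for \<open>\<rho> ^ (L + 1)\<close>; returning to \<open>\<rho> ^ L\<close> costs the factor
        \<open>1 / \<rho>\<close>.\<close>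
      have "real N \<le> R ^ (L + 1)" using L(2) unfolding R_def of_nat_power[symmetric] by linarith
      then have "(R ^ (L + 1)) powr (-\<delta>) \<le> real N powr (-\<delta>)"
        using N1 delta by (intro powr_mono2') auto
      also have "(R ^ (L + 1)) powr (-\<delta>) = \<rho> ^ (L + 1)"
        unfolding rho_eq using R by (simp only: powr_power powr_realpow[symmetric] powr_powr mult.commute)
      also have "real N powr (-\<delta>) \<le> real N powr (-c)"
        using N1 by (intro powr_mono) (auto simp: c_def)
      finally show ?thesis using rho by (simp add: field_simps)
    qed
    also have "real M / real N \<le> real N powr (-c)"
    proof -
      have "M ^ 2 \<le> N" using L(1) by (simp add: M_def power_mult[symmetric] mult.commute)
      then have "(real M) ^ 2 \<le> real N" unfolding of_nat_power[symmetric] by (rule of_nat_mono)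
      then have "real M \<le> sqrt (real N)" by (rule real_le_rsqrt)
      then have "real M / real N \<le> sqrt (real N) / real N"
        using N1 by (intro divide_right_mono) auto
      also have "\<dots> = real N powr (1/2 - 1)"
        using N1 by (subst powr_diff) (simp add: powr_half_sqrt)
      also have "\<dots> \<le> real N powr (-c)"
        using N1 by (intro powr_mono) (auto simp: c_def)
      finally show ?thesis .
    qed
    finally show ?thesis using A by (simp add: algebra_simps)
  qed
  moreover have "c > 0" "1 / \<rho> + A > 0" using delta rho A by (auto simp: c_def intro: add_pos_pos)
  ultimately show ?thesis by blast
qed

theorem theoremB:
  fixes s :: nat
  assumes "s \<ge> 1"
  shows "\<exists>c::real. c > 0 \<and>
    (\<lambda>N::nat. gowers_norm s N rudin_shapiro) \<in> O(\<lambda>N. real N powr (-c))"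
proof -
  obtain c C where c: "c > 0" and C: "C > 0"
    and le: "\<And>N. N \<ge> Suc s \<Longrightarrow> \<bar>gowers_pow s N rudin_shapiro\<bar> \<le> C * real N powr (-c)"
    using gowers_pow_rudin_shapiro_bound[OF assms] by blast
  \<comment> \<open>The norm is a root of order \<open>2 ^ s\<close>, which divides the exponent by
    \<open>k\<close>.\<close>
  define k :: nat where "k = 2 ^ s"
  have k: "k > 0" by (simp add: k_def)
  have "\<bar>gowers_norm s N rudin_shapiro\<bar> \<le> root k C * \<bar>real N powr (-(c / k))\<bar>" if N: "N \<ge> Suc s" for N
  proof -
    have "\<bar>gowers_norm s N rudin_shapiro\<bar> = root k \<bar>gowers_pow s N rudin_shapiro\<bar>"
      using k by (simp add: gowers_norm_def k_def real_root_abs)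
    also have "\<dots> \<le> root k (C * real N powr (-c))"
      using le[OF N] k by simp
    also have "\<dots> = root k C * (real N powr (-c)) powr (1 / k)"
      using k N by (simp add: real_root_mult root_powr_inverse)
    also have "\<dots> = root k C * \<bar>real N powr (-(c / k))\<bar>"
      by (simp add: powr_powr)
    finally show ?thesis .
  qed
  then have "(\<lambda>N. gowers_norm s N rudin_shapiro) \<in> O(\<lambda>N. real N powr (-(c / k)))"
    by (intro bigoI[where c = "root k C"] eventually_sequentiallyI[of "Suc s"]) auto
  then show ?thesis using c k by (intro exI[of _ "c / k"]) auto
qed

end
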